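(* Let $X$ be a finite connected poset and $F$ a field with $\mathrm{char}(F)\notin\{2,3\}$. Then every bijective $F$-linear map $\varphi:I(X,F)\to I(X,F)$ with $\varphi(T(I(X,F)))\subseteq T(I(X,F))$ is of the form $\varphi=r\psi$, where $r\in\{-1,1\}$ and $\psi$ is either an automorphism or an anti-automorphism of $I(X,F)$.
   Context: $I(X,F)$ is the incidence algebra of the locally finite poset $X$ over $F$ (functions $f:X\times X\to F$ vanishing unless $x\le y$, with product $(fg)(x,y)=\sum_{x\le z\le y}f(x,z)g(z,y)$). A poset is connected if any two elements are joined by a finite sequence of elements in which consecutive elements are comparable. $T(A)=\{a: a^3=a\}$ denotes the tripotents of $A$. *)

theory Defs
  imports Main
begin

definition is_poset :: "'a set \<Rightarrow> ('a \<Rightarrow> 'a \<Rightarrow> bool) \<Rightarrow> bool" where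
  "is_poset X le \<longleftrightarrow>
     (\<forall>x\<in>X. le x x) \<and>
     (\<forall>x\<in>X. \<forall>y\<in>X. le x y \<and> le y x \<longrightarrow> x = y) \<and>
     (\<forall>x\<in>X. \<forall>y\<in>X. \<forall>z\<in>X. le x y \<and> le y z \<longrightarrow> le x z)"

definition comparable_in :: "'a set \<Rightarrow> ('a \<Rightarrow> 'a \<Rightarrow> bool) \<Rightarrow> 'a \<Rightarrow> 'a \<Rightarrow> bool" where
  "comparable_in X le u v \<longleftrightarrow> u \<in> X \<and> v \<in> X \<and> (le u v \<or> le v u)"

definition poset_connected :: "'a set \<Rightarrow> ('a \<Rightarrow> 'a \<Rightarrow> bool) \<Rightarrow> bool" where
  "poset_connected X le \<longleftrightarrow> (\<forall>x\<in>X. \<forall>y\<in>X. (comparable_in X le)\<^sup>*\<^sup>* x y)"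

definition incidence :: "'a set \<Rightarrow> ('a \<Rightarrow> 'a \<Rightarrow> bool) \<Rightarrow> ('a \<Rightarrow> 'a \<Rightarrow> 'b::field) set" where
  "incidence X le = {f. \<forall>x y. f x y \<noteq> 0 \<longrightarrow> x \<in> X \<and> y \<in> X \<and> le x y}"

definition inc_mult :: "'a set \<Rightarrow> ('a \<Rightarrow> 'a \<Rightarrow> bool) \<Rightarrow>
    ('a \<Rightarrow> 'a \<Rightarrow> 'b::field) \<Rightarrow> ('a \<Rightarrow> 'a \<Rightarrow> 'b) \<Rightarrow> ('a \<Rightarrow> 'a \<Rightarrow> 'b)" where
  "inc_mult X le f g = (\<lambda>x y. \<Sum>z\<in>{z\<in>X. le x z \<and> le z y}. f x z * g z y)"

definition inc_add :: "('a \<Rightarrow> 'a \<Rightarrow> 'b::field) \<Rightarrow> ('a \<Rightarrow> 'a \<Rightarrow> 'b) \<Rightarrow> ('a \<Rightarrow> 'a \<Rightarrow> 'b)" where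
  "inc_add f g = (\<lambda>x y. f x y + g x y)"

definition inc_smult :: "'b::field \<Rightarrow> ('a \<Rightarrow> 'a \<Rightarrow> 'b) \<Rightarrow> ('a \<Rightarrow> 'a \<Rightarrow> 'b)" where
  "inc_smult c f = (\<lambda>x y. c * f x y)"

definition tripotents :: "'a set \<Rightarrow> ('a \<Rightarrow> 'a \<Rightarrow> bool) \<Rightarrow> ('a \<Rightarrow> 'a \<Rightarrow> 'b::field) set" where
  "tripotents X le = {a \<in> incidence X le. inc_mult X le (inc_mult X le a a) a = a}"

definition inc_linear :: "'a set \<Rightarrow> ('a \<Rightarrow> 'a \<Rightarrow> bool) \<Rightarrow>
    (('a \<Rightarrow> 'a \<Rightarrow> 'b::field) \<Rightarrow> ('a \<Rightarrow> 'a \<Rightarrow> 'b)) \<Rightarrow> bool" where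
  "inc_linear X le \<phi> \<longleftrightarrow>
     (\<forall>f\<in>incidence X le. \<forall>g\<in>incidence X le. \<phi> (inc_add f g) = inc_add (\<phi> f) (\<phi> g)) \<and>
     (\<forall>c. \<forall>f\<in>incidence X le. \<phi> (inc_smult c f) = inc_smult c (\<phi> f))"

definition inc_automorphism :: "'a set \<Rightarrow> ('a \<Rightarrow> 'a \<Rightarrow> bool) \<Rightarrow>
    (('a \<Rightarrow> 'a \<Rightarrow> 'b::field) \<Rightarrow> ('a \<Rightarrow> 'a \<Rightarrow> 'b)) \<Rightarrow> bool" where
  "inc_automorphism X le \<psi> \<longleftrightarrow>
     bij_betw \<psi> (incidence X le) (incidence X le) \<and> inc_linear X le \<psi> \<and>
     (\<forall>f\<in>incidence X le. \<forall>g\<in>incidence X le.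
        \<psi> (inc_mult X le f g) = inc_mult X le (\<psi> f) (\<psi> g))"

definition inc_anti_automorphism :: "'a set \<Rightarrow> ('a \<Rightarrow> 'a \<Rightarrow> bool) \<Rightarrow>
    (('a \<Rightarrow> 'a \<Rightarrow> 'b::field) \<Rightarrow> ('a \<Rightarrow> 'a \<Rightarrow> 'b)) \<Rightarrow> bool" where
  "inc_anti_automorphism X le \<psi> \<longleftrightarrow>
     bij_betw \<psi> (incidence X le) (incidence X le) \<and> inc_linear X le \<psi> \<and>
     (\<forall>f\<in>incidence X le. \<forall>g\<in>incidence X le.
        \<psi> (inc_mult X le f g) = inc_mult X le (\<psi> g) (\<psi> f))"

end

theory Submission
  imports Defs "HOL-Library.Function_Algebras"
begin

text \<open>
  Expanding \<open>(p \<plusminus> q)\<^sup>3\<close> shows that, without 2- and 3-torsion, tripotents \<open>p\<close>, \<open>q\<close> whose sum and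
  difference are tripotent satisfy \<open>pq = 0\<close>; so \<open>\<phi>\<close> preserves orthogonality of idempotents.
  The images of the diagonal units are nonzero orthogonal tripotents. A nonzero
  tripotent has a nonzero diagonal, so each image has a single diagonal entry
  \<open>\<epsilon> x = \<plusminus>1\<close>, at \<open>\<sigma> x\<close> for a permutation \<open>\<sigma>\<close> of \<open>X\<close>, and after a conjugation \<open>\<phi>\<close> maps
  \<open>E x x\<close> to \<open>\<epsilon> x E (\<sigma> x) (\<sigma> x)\<close>.

  For \<open>x < y\<close> the elements \<open>E x x + c E x y\<close> are idempotent for all \<open>c\<close>, and Peirce considerations
  force the image of \<open>E x y\<close> to be a multiple of \<open>E (\<sigma> x) (\<sigma> y)\<close> or of \<open>E (\<sigma> y) (\<sigma> x)\<close>. Orthogonality of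
  \<open>E x x + E x y\<close> and \<open>E y y - E x y\<close> gives \<open>\<epsilon> x = \<epsilon> y\<close>. For \<open>x < y < z\<close> the idempotent
  \<open>E y y + E x y + E y z + E x z\<close> shows that the three edges have the same orientation and that the
  coefficients form a cocycle up to the sign. Two edges at a common vertex with incomparable other
  ends also have the same orientation, since \<open>\<sigma>\<close> reflects comparability; so connectedness makes
  sign and orientation global.
\<close>

section \<open>Tripotents in a ring\<close>

text \<open>The two expansions force the part \<open>S1\<close> of degree one in \<open>q\<close> to
  vanish. Comparing \<open>p * S1\<close> with \<open>S1 * p\<close> then gives
  \<open>p * q = q * p\<close>, so \<open>S1\<close> becomes three times \<open>p * p * q\<close>,
  and a further factor \<open>p\<close> turns \<open>p * p * q = 0\<close> into the claim.\<close>

lemma (in ring) orthogonal_of_tripotents: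
  assumes two: "\<And>x. x + x = 0 \<Longrightarrow> x = 0" and three: "\<And>x. x + x + x = 0 \<Longrightarrow> x = 0"
    and p: "p * p * p = p" and q: "q * q * q = q"
    and plus: "(p + q) * (p + q) * (p + q) = p + q"
    and minus: "(p - q) * (p - q) * (p - q) = p - q"
  shows "p * q = 0"
proof -
  define S1 where "S1 = p * p * q + p * q * p + q * p * p"
  define S2 where "S2 = p * q * q + q * p * q + q * q * p"
  have 1: "(p + q) * (p + q) * (p + q) = p * p * p + S1 + S2 + q * q * q"
    by (simp add: S1_def S2_def algebra_simps)
  have 2: "(p - q) * (p - q) * (p - q) = p * p * p - S1 + S2 - q * q * q"
    by (simp add: S1_def S2_def algebra_simps)
  have a: "S1 + S2 = 0"
  proof -
    have "p + S1 + S2 + q = p + q" using 1 plus p q by simp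
    then have "(S1 + S2) + (p + q) = 0 + (p + q)" by (simp add: algebra_simps)
    then show ?thesis by (simp only: add_right_cancel)
  qed
  have b: "S2 = S1"
  proof -
    have "p - S1 + S2 - q = p - q" using 2 minus p q by simp
    then have "S2 + (p - q) = S1 + (p - q)" by (simp add: algebra_simps)
    then show ?thesis by (simp only: add_right_cancel)
  qed
  have S1: "S1 = 0" by (rule two) (use a b in simp)
  have "p * S1 = p * q + p * p * q * p + p * q * p * p"
    using p by (simp add: S1_def algebra_simps) (simp add: mult_assoc[symmetric])
  moreover have "S1 * p = q * p + p * p * q * p + p * q * p * p"
    using p by (simp add: S1_def algebra_simps)
  ultimately have comm: "q * p = p * q"
    using S1 by (metis add_right_cancel mult_zero_left mult_zero_right)
  have "p * q * p = p * p * q" "q * p * p = p * p * q"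
    by (metis comm mult_assoc)+
  then have "p * p * q + p * p * q + p * p * q = 0"
    using S1 by (simp add: S1_def)
  then have "p * p * q = 0" by (rule three)
  then have "p * (p * p * q) = 0" by simp
  then show ?thesis using p by (simp add: mult_assoc[symmetric])
qed

text \<open>No cube law is assumed for \<open>n\<close>, so its cubic part \<open>S3\<close> is a
  third unknown beside \<open>S1\<close> and \<open>S2\<close>. The coefficients 1, -1 and 2 of
  \<open>n\<close> give three equations that separate them: \<open>S2\<close> and six times
  \<open>S3\<close> vanish, which leaves \<open>S1 = n\<close>.\<close>

lemma (in ring) Peirce_of_tripotents:
  assumes two: "\<And>x. x + x = 0 \<Longrightarrow> x = 0" and three: "\<And>x. x + x + x = 0 \<Longrightarrow> x = 0"
    and p: "p * p * p = p"
    and plus: "(p + n) * (p + n) * (p + n) = p + n"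
    and minus: "(p - n) * (p - n) * (p - n) = p - n"
    and plus2: "(p + n + n) * (p + n + n) * (p + n + n) = p + n + n"
  shows "p * p * n + p * n * p + n * p * p = n"
proof -
  define S1 where "S1 = p * p * n + p * n * p + n * p * p"
  define S2 where "S2 = p * n * n + n * p * n + n * n * p"
  define S3 where "S3 = n * n * n"
  have "(p + n) * (p + n) * (p + n) = p * p * p + S1 + S2 + S3"
    by (simp add: S1_def S2_def S3_def algebra_simps)
  then have "p + S1 + S2 + S3 = p + n" by (simp only: plus p)
  then have "p + (S1 + S2 + S3) = p + n" by (simp add: add_assoc)
  then have 1: "S1 + S2 + S3 = n" by (simp only: add_left_cancel)
  have "(p - n) * (p - n) * (p - n) = p * p * p - S1 + S2 - S3"
    by (simp add: S1_def S2_def S3_def algebra_simps)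
  then have "p - S1 + S2 - S3 = p - n" by (simp only: minus p)
  then have "p + (S2 - S1 - S3) = p + (- n)" by (simp add: algebra_simps)
  then have 2: "S2 - S1 - S3 = - n" by (simp only: add_left_cancel)
  have "(p + n + n) * (p + n + n) * (p + n + n) = p * p * p + (S1 + S1) + (S2 + S2 + S2 + S2)
      + (S3 + S3 + S3 + S3 + S3 + S3 + S3 + S3)"
    by (simp add: S1_def S2_def S3_def algebra_simps)
  then have "p + (S1 + S1) + (S2 + S2 + S2 + S2)
      + (S3 + S3 + S3 + S3 + S3 + S3 + S3 + S3) = p + n + n"
    by (simp only: plus2 p)
  then have "p + ((S1 + S1) + (S2 + S2 + S2 + S2)
      + (S3 + S3 + S3 + S3 + S3 + S3 + S3 + S3)) = p + (n + n)"
    by (simp add: add_assoc)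
  then have 3: "(S1 + S1) + (S2 + S2 + S2 + S2)
      + (S3 + S3 + S3 + S3 + S3 + S3 + S3 + S3) = n + n" by (simp only: add_left_cancel)
  have "S2 + S2 = (S1 + S2 + S3) + (S2 - S1 - S3)" by (simp add: algebra_simps)
  then have "S2 + S2 = n + (- n)" by (simp only: 1 2)
  then have "S2 + S2 = 0" by simp
  then have S2: "S2 = 0" by (rule two)
  have S1: "n = S1 + S3" using 1 unfolding S2 by simp
  have "(S3 + S3 + S3) + (S3 + S3 + S3) + (S1 + S1 + (S3 + S3)) = 0 + (S1 + S1 + (S3 + S3))"
    using 3 unfolding S2 S1 by (simp add: algebra_simps)
  then have "(S3 + S3 + S3) + (S3 + S3 + S3) = 0" by (simp only: add_right_cancel)
  then have "S3 = 0" by (rule three[OF two])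
  with S1 show ?thesis by (simp add: S1_def)
qed

section \<open>The incidence algebra as a matrix ring\<close>

locale finite_poset =
  fixes X :: "'a set" and le :: "'a \<Rightarrow> 'a \<Rightarrow> bool"
  assumes fin: "finite X" and poset: "is_poset X le"
begin

text \<open>
  Summing over all of \<open>X\<close> agrees with \<open>inc_mult\<close> on the incidence algebra, but makes all functions a
  (non-unital) ring; the symbol \<open>*\<close> on functions is the pointwise product of the library.
\<close>
definition prod :: "('a \<Rightarrow> 'a \<Rightarrow> 'b::field) \<Rightarrow> ('a \<Rightarrow> 'a \<Rightarrow> 'b) \<Rightarrow> 'a \<Rightarrow> 'a \<Rightarrow> 'b" (infixl "\<cdot>" 70)
  where "f \<cdot> g = (\<lambda>x y. \<Sum>z\<in>X. f x z * g z y)"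

abbreviation smult :: "'b::field \<Rightarrow> ('a \<Rightarrow> 'a \<Rightarrow> 'b) \<Rightarrow> 'a \<Rightarrow> 'a \<Rightarrow> 'b" (infixr "*\<^sub>s" 75)
  where "c *\<^sub>s f \<equiv> inc_smult c f"

sublocale mat: ring where times = "prod :: ('a \<Rightarrow> 'a \<Rightarrow> 'b::field) \<Rightarrow> _"
    and plus = "(+)" and minus = "(-)" and uminus = uminus and zero = 0
proof (unfold_locales, goal_cases)
  case (1 a b c)
  have "(\<Sum>z\<in>X. (\<Sum>w\<in>X. a x w * b w z) * c z y) = (\<Sum>w\<in>X. a x w * (\<Sum>z\<in>X. b w z * c z y))" for x y
  proof -
    have "(\<Sum>z\<in>X. (\<Sum>w\<in>X. a x w * b w z) * c z y) = (\<Sum>z\<in>X. \<Sum>w\<in>X. a x w * b w z * c z y)"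
      by (simp add: sum_distrib_right)
    also have "\<dots> = (\<Sum>w\<in>X. \<Sum>z\<in>X. a x w * b w z * c z y)"
      by (rule sum.swap)
    finally show ?thesis by (simp add: sum_distrib_left mult.assoc)
  qed
  then show ?case by (simp add: prod_def)
qed (auto simp: prod_def fun_eq_iff sum.distrib algebra_simps)

abbreviation A :: "('a \<Rightarrow> 'a \<Rightarrow> 'b::field) set" where "A \<equiv> incidence X le"

text \<open>The matrix units, defined for all pairs; \<open>E a b\<close> belongs to
  \<open>A\<close> only if \<open>le a b\<close> holds in \<open>X\<close>.\<close>

definition E :: "'a \<Rightarrow> 'a \<Rightarrow> 'a \<Rightarrow> 'a \<Rightarrow> 'b::field"
  where "E a b = (\<lambda>x y. if x = a \<and> y = b then 1 else 0)"

lemma le_refl: "x \<in> X \<Longrightarrow> le x x"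
  and le_antisym: "\<lbrakk>x \<in> X; y \<in> X; le x y; le y x\<rbrakk> \<Longrightarrow> x = y"
  and le_trans: "\<lbrakk>x \<in> X; y \<in> X; z \<in> X; le x y; le y z\<rbrakk> \<Longrightarrow> le x z"
  using poset unfolding is_poset_def by blast+

lemma incD: "f \<in> A \<Longrightarrow> f x y \<noteq> 0 \<Longrightarrow> x \<in> X \<and> y \<in> X \<and> le x y"
  by (auto simp: incidence_def)

lemma inc_eqI:
  assumes "f \<in> A" "g \<in> A" "\<And>x y. \<lbrakk>x \<in> X; y \<in> X\<rbrakk> \<Longrightarrow> f x y = g x y"
  shows "f = g"
proof (intro ext)
  show "f x y = g x y" for x y
    using assms incD[OF assms(1), of x y] incD[OF assms(2), of x y] by metis
qed

lemma inc_iff: "f \<in> A \<longleftrightarrow> (\<forall>x y. \<not> (x \<in> X \<and> y \<in> X \<and> le x y) \<longrightarrow> f x y = 0)"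
  unfolding incidence_def by blast

lemma zero_inc [simp]: "0 \<in> A"
  and add_inc [simp]: "\<lbrakk>f \<in> A; g \<in> A\<rbrakk> \<Longrightarrow> f + g \<in> A"
  and diff_inc [simp]: "\<lbrakk>f \<in> A; g \<in> A\<rbrakk> \<Longrightarrow> f - g \<in> A"
  and smult_inc [simp]: "f \<in> A \<Longrightarrow> c *\<^sub>s f \<in> A"
  by (simp_all add: inc_iff inc_smult_def)

lemma prod_inc [simp]:
  assumes "f \<in> A" "g \<in> A" shows "f \<cdot> g \<in> A"
  unfolding incidence_def
proof (intro CollectI allI impI)
  fix x y assume "(f \<cdot> g) x y \<noteq> 0"
  then obtain z where "z \<in> X" "f x z * g z y \<noteq> 0"
    unfolding prod_def by (meson sum.neutral)
  then show "x \<in> X \<and> y \<in> X \<and> le x y"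
    using incD[OF assms(1), of x z] incD[OF assms(2), of z y] le_trans by auto
qed

lemma sum_inc: "\<lbrakk>\<And>i. i \<in> S \<Longrightarrow> h i \<in> A\<rbrakk> \<Longrightarrow> sum h S \<in> A"
  by (induction S rule: infinite_finite_induct) auto

lemma E_inc [simp]: "\<lbrakk>a \<in> X; b \<in> X; le a b\<rbrakk> \<Longrightarrow> E a b \<in> A"
  by (auto simp: E_def incidence_def split: if_splits)

lemma E_diag_inc [simp]: "a \<in> X \<Longrightarrow> E a a \<in> A"
  using le_refl by simp

lemma inc_mult_eq_prod:
  assumes "f \<in> A" "g \<in> A" shows "inc_mult X le f g = f \<cdot> g"
  unfolding inc_mult_def prod_def
proof (intro ext sum.mono_neutral_left)
  show "\<forall>i\<in>X - {z \<in> X. le x z \<and> le z y}. f x i * g i y = 0" for x y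
    using incD[OF assms(1)] incD[OF assms(2)] by force
qed (use fin in auto)

lemma tripotents_iff: "f \<in> tripotents X le \<longleftrightarrow> f \<in> A \<and> f \<cdot> f \<cdot> f = f"
  by (auto simp: tripotents_def inc_mult_eq_prod)

lemma smult_prod_left [simp]: "(c *\<^sub>s f) \<cdot> g = c *\<^sub>s (f \<cdot> g)"
  and smult_prod_right [simp]: "f \<cdot> (c *\<^sub>s g) = c *\<^sub>s (f \<cdot> g)"
  and smult_smult [simp]: "c *\<^sub>s d *\<^sub>s f = (c * d) *\<^sub>s f"
  and smult_one [simp]: "1 *\<^sub>s f = f"
  and smult_zero [simp]: "0 *\<^sub>s f = 0"
  and smult_zero_right [simp]: "c *\<^sub>s 0 = (0 :: 'a \<Rightarrow> 'a \<Rightarrow> 'b::field)"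
  by (auto simp: prod_def inc_smult_def fun_eq_iff sum_distrib_left mult_ac)

lemma smult_add: "c *\<^sub>s (f + g) = c *\<^sub>s f + c *\<^sub>s g"
  by (simp add: inc_smult_def fun_eq_iff distrib_left)

lemma smult_two: "2 *\<^sub>s f = f + f"
  by (simp add: inc_smult_def fun_eq_iff)

lemma inc_add_eq_plus: "inc_add f g = f + g"
  by (simp add: inc_add_def fun_eq_iff)

section \<open>Products with matrix units\<close>

lemma E_prod:
  assumes "b \<in> X" shows "E a b \<cdot> E c d = (if b = c then E a d else 0)"
proof (intro ext)
  fix x y
  have "(E a b \<cdot> E c d) x y = (\<Sum>z\<in>X. if z = b then (if x = a \<and> y = d \<and> b = c then 1 else 0) else 0)"
    unfolding prod_def by (intro sum.cong) (auto simp: E_def)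
  also have "\<dots> = (if b = c then E a d else 0) x y"
    using assms fin by (simp add: E_def)
  finally show "(E a b \<cdot> E c d) x y = (if b = c then E a d else 0) x y" .
qed

lemma E_prod_left:
  assumes "b \<in> X" shows "(E a b \<cdot> f) x y = (if x = a then f b y else 0)"
proof -
  have "(E a b \<cdot> f) x y = (\<Sum>z\<in>X. if z = b then (if x = a then f b y else 0) else 0)"
    unfolding prod_def by (intro sum.cong) (auto simp: E_def)
  then show ?thesis using assms fin by simp
qed

lemma E_prod_right:
  assumes "a \<in> X" shows "(f \<cdot> E a b) x y = (if y = b then f x a else 0)"
proof -
  have "(f \<cdot> E a b) x y = (\<Sum>z\<in>X. if z = a then (if y = b then f x a else 0) else 0)"
    unfolding prod_def by (intro sum.cong) (auto simp: E_def)
  then show ?thesis using assms fin by simp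
qed

lemma E_corner:
  assumes "a \<in> X" "b \<in> X" shows "E a a \<cdot> f \<cdot> E b b = f a b *\<^sub>s E a b"
  using assms by (auto simp: fun_eq_iff E_prod_left E_prod_right inc_smult_def) (auto simp: E_def)

section \<open>Diagonal entries, triangularity and the identity\<close>

lemma sum_fun_apply2: "sum h S x y = (\<Sum>i\<in>S. h i x y)"
  by (induction S rule: infinite_finite_induct) auto

text \<open>A term with index \<open>z\<close> needs both \<open>le s z\<close> and
  \<open>le z s\<close>, so antisymmetry leaves only \<open>z = s\<close>.\<close>

lemma prod_diag:
  assumes "f \<in> A" "g \<in> A" "s \<in> X" shows "(f \<cdot> g) s s = f s s * g s s"
proof -
  have "(f \<cdot> g) s s = (\<Sum>z\<in>X. if z = s then f s s * g s s else 0)"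
    unfolding prod_def
  proof (intro sum.cong refl)
    fix z assume "z \<in> X"
    then show "f s z * g z s = (if z = s then f s s * g s s else 0)"
      using incD[OF assms(1), of s z] incD[OF assms(2), of z s] le_antisym[of s z] by auto
  qed
  then show ?thesis using fin assms by simp
qed

text \<open>Since \<open>d\<close> is strictly upper triangular, right multiplication by it is
  nilpotent. Concretely, a nonzero entry of \<open>c \<cdot> d\<close> in column \<open>y\<close>
  requires a nonzero entry of \<open>c\<close> in the same row and in a column strictly below
  \<open>y\<close>.\<close>

lemma eq_zero_of_factor_strictly_upper:
  assumes "c \<in> A" "d \<in> A" and diag: "\<And>s. s \<in> X \<Longrightarrow> d s s = 0" and eq: "c = c \<cdot> d"
  shows "c = 0"
proof (rule ccontr)
  assume "c \<noteq> 0"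
  then obtain x y0 where "c x y0 \<noteq> 0" by (auto simp: fun_eq_iff)
  \<comment> \<open>Among the nonzero entries of row \<open>x\<close>, a column with the smallest
    down-set is chosen.\<close>
  then obtain y where y: "c x y \<noteq> 0"
    and least: "\<And>z. c x z \<noteq> 0 \<Longrightarrow> card {w \<in> X. le w y} \<le> card {w \<in> X. le w z}"
    using ex_has_least_nat[of "\<lambda>y. c x y \<noteq> 0" y0 "\<lambda>y. card {w \<in> X. le w y}"] by metis
  have "(c \<cdot> d) x y \<noteq> 0" using y eq by simp
  then obtain z where "z \<in> X" "c x z * d z y \<noteq> 0"
    unfolding prod_def by (meson sum.neutral)
  then have z: "z \<in> X" "c x z \<noteq> 0" "d z y \<noteq> 0" by auto
  have zy: "y \<in> X" "le z y" "z \<noteq> y" using incD[OF assms(2) z(3)] diag z by auto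
  have "{w \<in> X. le w z} \<subset> {w \<in> X. le w y}"
    using z zy le_trans[of _ z y] le_antisym[of y z] le_refl by blast
  then have "card {w \<in> X. le w z} < card {w \<in> X. le w y}"
    using fin by (intro psubset_card_mono) auto
  with least[OF z(2)] show False by simp
qed

lemma sum_prod_left: "sum h S \<cdot> g = (\<Sum>i\<in>S. h i \<cdot> g)"
  by (induction S rule: infinite_finite_induct) (simp_all only: sum.infinite sum.empty sum.insert mat.mult_zero_left mat.distrib_right simp_thms)

lemma sum_prod_right: "g \<cdot> sum h S = (\<Sum>i\<in>S. g \<cdot> h i)"
  by (induction S rule: infinite_finite_induct) (simp_all only: sum.infinite sum.empty sum.insert mat.mult_zero_right mat.distrib_left simp_thms)

text \<open>It acts as identity on \<open>A\<close>, but not on functions with nonzero values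
  outside \<open>X\<close>; hence the membership premise of \<open>one_prod\<close>.\<close>

definition one :: "'a \<Rightarrow> 'a \<Rightarrow> 'b::field"
  where "one = (\<Sum>x\<in>X. E x x)"

lemma one_apply: "one x y = (if x = y \<and> x \<in> X then 1 else 0)"
proof -
  have "one x y = (\<Sum>z\<in>X. if z = x then (if x = y then 1 else 0) else 0)"
    unfolding one_def sum_fun_apply2 by (intro sum.cong) (auto simp: E_def)
  then show ?thesis using fin by auto
qed

lemma one_inc [simp]: "one \<in> A"
  by (auto simp: one_def intro: sum_inc)

lemma one_prod [simp]:
  assumes "f \<in> A" shows "one \<cdot> f = f" "f \<cdot> one = f"
proof -
  have "(one \<cdot> f) x y = (\<Sum>z\<in>X. if z = x then f x y else 0)" for x y
    unfolding prod_def using incD[OF assms, of x y] by (intro sum.cong) (auto simp: one_apply)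
  then show "one \<cdot> f = f"
    using incD[OF assms] fin by (fastforce simp: fun_eq_iff)
  have "(f \<cdot> one) x y = (\<Sum>z\<in>X. if z = y then f x y else 0)" for x y
    unfolding prod_def using incD[OF assms, of x y] by (intro sum.cong) (auto simp: one_apply)
  then show "f \<cdot> one = f"
    using incD[OF assms] fin by (fastforce simp: fun_eq_iff)
qed

text \<open>\<open>1 - B B'\<close> is an idempotent with zero diagonal, hence nilpotent, hence zero.\<close>
lemma right_inverse_of_left_inverse:
  assumes "B \<in> A" "B' \<in> A" and inv: "B' \<cdot> B = one"
  shows "B \<cdot> B' = one"
proof -
  let ?C = "one - B \<cdot> B'"
  have CA: "?C \<in> A" using assms by simp
  have "B \<cdot> B' \<cdot> (B \<cdot> B') = B \<cdot> (B' \<cdot> B) \<cdot> B'" by (simp add: mat.mult.assoc)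
  then have "?C \<cdot> ?C = ?C"
    using assms by (simp add: mat.left_diff_distrib mat.right_diff_distrib)
  moreover have "?C s s = 0" if "s \<in> X" for s
  proof -
    have "(B \<cdot> B') s s = (B' \<cdot> B) s s"
      using assms(1,2) that by (simp add: prod_diag mult.commute)
    then show ?thesis using that by (simp add: inv one_apply)
  qed
  ultimately have "?C = 0"
    using eq_zero_of_factor_strictly_upper[OF CA CA] by simp
  then show ?thesis by simp
qed

end

section \<open>Linear maps preserving tripotents\<close>

locale tripotent_map = finite_poset +
  fixes \<phi> :: "('a \<Rightarrow> 'a \<Rightarrow> 'b::field) \<Rightarrow> ('a \<Rightarrow> 'a \<Rightarrow> 'b)"
  assumes two: "(2::'b) \<noteq> 0" and three: "(3::'b) \<noteq> 0"
    and lin: "inc_linear X le \<phi>"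
    and bij: "bij_betw \<phi> A A"
    and trip: "\<phi> ` tripotents X le \<subseteq> tripotents X le"
begin

lemma two_torsion_free:
  fixes f :: "'a \<Rightarrow> 'a \<Rightarrow> 'b"
  assumes "f + f = 0" shows "f = 0"
proof -
  have "2 * f x y = 0" for x y using fun_cong[OF fun_cong[OF assms, of x], of y] by simp
  then show ?thesis using two by (auto simp: fun_eq_iff)
qed

lemma three_torsion_free:
  fixes f :: "'a \<Rightarrow> 'a \<Rightarrow> 'b"
  assumes "f + f + f = 0" shows "f = 0"
proof -
  have "3 * f x y = 0" for x y using fun_cong[OF fun_cong[OF assms, of x], of y] by simp
  then show ?thesis using three by (auto simp: fun_eq_iff)
qed

lemma map_inc [simp]: "f \<in> A \<Longrightarrow> \<phi> f \<in> A"
  using bij by (auto simp: bij_betw_def)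

lemma map_add: "\<lbrakk>f \<in> A; g \<in> A\<rbrakk> \<Longrightarrow> \<phi> (f + g) = \<phi> f + \<phi> g"
  and map_smult: "f \<in> A \<Longrightarrow> \<phi> (c *\<^sub>s f) = c *\<^sub>s \<phi> f"
  using lin unfolding inc_linear_def inc_add_eq_plus by blast+

lemma map_zero: "\<phi> 0 = 0"
  using map_smult[OF zero_inc, of 0] by (simp only: smult_zero)

lemma map_diff: 
  assumes "f \<in> A" "g \<in> A" shows "\<phi> (f - g) = \<phi> f - \<phi> g"
  using map_add[of "f - g" g, OF diff_inc[OF assms] assms(2)] by (simp only: eq_diff_eq diff_add_cancel)

lemma map_eq_zero: "f \<in> A \<Longrightarrow> \<phi> f = 0 \<Longrightarrow> f = 0"
  using inj_onD[OF bij_betw_imp_inj_on[OF bij], of f 0] map_zero by (simp only: zero_inc)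

lemma map_tripotent: "\<lbrakk>f \<in> A; f \<cdot> f \<cdot> f = f\<rbrakk> \<Longrightarrow> \<phi> f \<cdot> \<phi> f \<cdot> \<phi> f = \<phi> f"
  using subsetD[OF trip imageI[of f]] by (simp only: tripotents_iff)

lemma map_idempotent: "\<lbrakk>f \<in> A; f \<cdot> f = f\<rbrakk> \<Longrightarrow> \<phi> f \<cdot> \<phi> f \<cdot> \<phi> f = \<phi> f"
  using map_tripotent by simp

text \<open>For orthogonal idempotents both \<open>f + g\<close> and \<open>f - g\<close> are
  tripotent, the latter because its square is \<open>f + g\<close>. So
  \<open>orthogonal_of_tripotents\<close> applies to the images.\<close>

lemma map_orthogonal:
  assumes "f \<in> A" "g \<in> A" "f \<cdot> f = f" "g \<cdot> g = g" "f \<cdot> g = 0" "g \<cdot> f = 0"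
  shows "\<phi> f \<cdot> \<phi> g = 0"
proof -
  have sq: "(f + g) \<cdot> (f + g) = f + g" "(f - g) \<cdot> (f - g) = f + g" "(f + g) \<cdot> (f - g) = f - g"
    by (simp_all add: assms(3-6) mat.distrib_left mat.distrib_right
        mat.left_diff_distrib mat.right_diff_distrib)
  have "\<phi> (f + g) \<cdot> \<phi> (f + g) \<cdot> \<phi> (f + g) = \<phi> (f + g)"
     "\<phi> (f - g) \<cdot> \<phi> (f - g) \<cdot> \<phi> (f - g) = \<phi> (f - g)"
    by (rule map_tripotent; simp add: sq assms(1,2))+
  moreover have "\<phi> f \<cdot> \<phi> f \<cdot> \<phi> f = \<phi> f" "\<phi> g \<cdot> \<phi> g \<cdot> \<phi> g = \<phi> g"
    by (rule map_idempotent; fact)+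
  ultimately show ?thesis
    unfolding map_add[OF assms(1,2)] map_diff[OF assms(1,2)]
    by - (rule mat.orthogonal_of_tripotents, erule two_torsion_free, erule three_torsion_free)
qed

lemma map_sum: "\<lbrakk>\<And>i. i \<in> S \<Longrightarrow> h i \<in> A\<rbrakk> \<Longrightarrow> \<phi> (sum h S) = (\<Sum>i\<in>S. \<phi> (h i))"
proof (induction S rule: infinite_finite_induct)
  case (insert x S)
  have hx: "h x \<in> A" by (rule insert.prems) simp
  have IH: "\<phi> (sum h S) = (\<Sum>i\<in>S. \<phi> (h i))" by (rule insert.IH, rule insert.prems) simp
  have "sum h S \<in> A" by (rule sum_inc, rule insert.prems) simp
  then show ?case
    by (simp only: sum.insert[OF insert.hyps] map_add[OF hx] IH)
qed (simp_all only: sum.infinite sum.empty map_zero not_False_eq_True)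

text \<open>Expand \<open>f\<close> in matrix units and use linearity. The sum runs over all pairs;
  where the matrix unit lies outside \<open>A\<close>, its coefficient is zero.\<close>

lemma map_apply:
  assumes "f \<in> A"
  shows "\<phi> f s t = (\<Sum>p\<in>X \<times> X. f (fst p) (snd p) * \<phi> (E (fst p) (snd p)) s t)"
proof -
  let ?h = "\<lambda>p. f (fst p) (snd p) *\<^sub>s E (fst p) (snd p)"
  have inc: "?h p \<in> A" for p
  proof (cases "f (fst p) (snd p) = 0")
    case False
    then show ?thesis using incD[OF assms False] by simp
  qed simp
  have "f x y = sum ?h (X \<times> X) x y" for x y
  proof -
    have "sum ?h (X \<times> X) x y = (\<Sum>p\<in>X\<times>X. if p = (x, y) then f x y else 0)"
      unfolding sum_fun_apply2 by (intro sum.cong) (auto simp: inc_smult_def E_def)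
    then show ?thesis using fin incD[OF assms, of x y] by auto
  qed
  then have "f = sum ?h (X \<times> X)" by (intro ext)
  then have "\<phi> f = \<phi> (sum ?h (X \<times> X))"
    by (rule arg_cong)
  then have "\<phi> f s t = (\<Sum>p\<in>X \<times> X. \<phi> (?h p)) s t"
    by (simp only: map_sum[of "X \<times> X" ?h, OF inc])
  also have "\<dots> = (\<Sum>p\<in>X \<times> X. f (fst p) (snd p) * \<phi> (E (fst p) (snd p)) s t)"
    unfolding sum_fun_apply2
  proof (intro sum.cong refl)
    fix p
    show "\<phi> (?h p) s t = f (fst p) (snd p) * \<phi> (E (fst p) (snd p)) s t"
    proof (cases "f (fst p) (snd p) = 0")
      case False
      then show ?thesis using incD[OF assms False] by (simp add: map_smult) (simp add: inc_smult_def)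
    qed (simp add: map_zero)
  qed
  finally show ?thesis .
qed

text \<open>This reads off an entry of \<open>\<phi> f\<close> to which a single basis element
  contributes.\<close>

lemma map_apply_single:
  assumes "f \<in> A" "x \<in> X" "y \<in> X"
    and other: "\<And>u v. \<lbrakk>u \<in> X; v \<in> X; le u v; (u, v) \<noteq> (x, y)\<rbrakk> \<Longrightarrow> \<phi> (E u v) s t = 0"
  shows "\<phi> f s t = f x y * \<phi> (E x y) s t"
proof -
  have "\<phi> f s t = (\<Sum>p\<in>X \<times> X. if p = (x, y) then f x y * \<phi> (E x y) s t else 0)"
    unfolding map_apply[OF assms(1)]
  proof (intro sum.cong refl)
    fix p :: "'a \<times> 'a"
    obtain u v where p: "p = (u, v)" by fastforce
    show "f (fst p) (snd p) * \<phi> (E (fst p) (snd p)) s t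
        = (if p = (x, y) then f x y * \<phi> (E x y) s t else 0)"
      using incD[OF assms(1), of u v] other[of u v] by (cases "f u v = 0") (auto simp: p)
  qed
  then show ?thesis using fin assms by simp
qed

end

section \<open>Maps permuting the diagonal units up to sign\<close>

text \<open>The normal form to which the conjugation from \<open>exists_diagonalization\<close>
  brings every \<open>tripotent_map\<close>.\<close>

locale diagonal_tripotent_map = tripotent_map +
  fixes \<sigma> :: "'a \<Rightarrow> 'a" and \<epsilon> :: "'a \<Rightarrow> 'b::field"
  assumes \<sigma>: "bij_betw \<sigma> X X"
    and map_diag: "x \<in> X \<Longrightarrow> \<phi> (E x x) = \<epsilon> x *\<^sub>s E (\<sigma> x) (\<sigma> x)"
    and \<epsilon>: "x \<in> X \<Longrightarrow> \<epsilon> x = 1 \<or> \<epsilon> x = - 1"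
begin

lemma \<sigma>_in [simp]: "x \<in> X \<Longrightarrow> \<sigma> x \<in> X"
  using \<sigma> by (auto simp: bij_betw_def)

lemma \<sigma>_eq_iff [simp]: "\<lbrakk>x \<in> X; y \<in> X\<rbrakk> \<Longrightarrow> \<sigma> x = \<sigma> y \<longleftrightarrow> x = y"
  using \<sigma> by (auto simp: bij_betw_def inj_on_def)

lemma \<epsilon>_sq: "x \<in> X \<Longrightarrow> \<epsilon> x * \<epsilon> x = 1"
  using \<epsilon>[of x] by auto

section \<open>Images of the off-diagonal matrix units\<close>

text \<open>At either endpoint \<open>a\<close>, the elements \<open>E a a + c E x y\<close> are
  idempotent. Since the sign of \<open>\<phi> (E a a)\<close> squares to 1, the Peirce identity
  reads \<open>e N + e N e + N e = N\<close> for the matrix unit \<open>e\<close> at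
  \<open>\<sigma> a\<close>. Outside row and column \<open>\<sigma> a\<close> this gives
  \<open>N s t = 0\<close>; where they cross it gives \<open>3 N s t = N s t\<close>, again zero
  because 2 is invertible.\<close>

lemma edge_support_endpoint:
  assumes xy: "x \<in> X" "y \<in> X" "le x y" "x \<noteq> y" and a: "a = x \<or> a = y"
    and ne: "\<phi> (E x y) s t \<noteq> 0"
  shows "s = \<sigma> a \<longleftrightarrow> t \<noteq> \<sigma> a"
proof -
  define N where "N = \<phi> (E x y)"
  define p where "p = \<phi> (E a a)"
  have aX: "a \<in> X" using a xy by auto
  have sq: "(E a a + E x y) \<cdot> (E a a + E x y) = E a a + E x y"
    "(E a a - E x y) \<cdot> (E a a - E x y) = E a a - E x y"
    "(E a a + 2 *\<^sub>s E x y) \<cdot> (E a a + 2 *\<^sub>s E x y) = E a a + 2 *\<^sub>s E x y"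
    using xy a by (auto simp: mat.distrib_left mat.distrib_right mat.left_diff_distrib
        mat.right_diff_distrib E_prod)
  have "p \<cdot> p \<cdot> N + p \<cdot> N \<cdot> p + N \<cdot> p \<cdot> p = N"
  proof (rule mat.Peirce_of_tripotents)
    show "p \<cdot> p \<cdot> p = p"
      unfolding p_def by (rule map_idempotent) (use aX in \<open>simp_all add: E_prod\<close>)
    have [simp]: "E a a \<in> A" "E x y \<in> A" using aX xy by simp_all
    show "(p + N) \<cdot> (p + N) \<cdot> (p + N) = p + N"
      using map_idempotent[OF _ sq(1)] by (simp add: map_add p_def N_def)
    show "(p - N) \<cdot> (p - N) \<cdot> (p - N) = p - N"
      using map_idempotent[OF _ sq(2)] by (simp add: map_diff p_def N_def)
    show "(p + N + N) \<cdot> (p + N + N) \<cdot> (p + N + N) = p + N + N"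
    proof -
      have "\<phi> (E a a + 2 *\<^sub>s E x y) = p + 2 *\<^sub>s N"
        by (simp add: map_add map_smult p_def N_def)
      then have "\<phi> (E a a + 2 *\<^sub>s E x y) = p + N + N"
        by (simp only: smult_two add.assoc)
      moreover have "E a a + 2 *\<^sub>s E x y \<in> A" by simp
      ultimately show ?thesis using map_idempotent[OF _ sq(3)] by (simp only:)
    qed
  qed (erule two_torsion_free three_torsion_free)+
  moreover have "p = \<epsilon> a *\<^sub>s E (\<sigma> a) (\<sigma> a)" unfolding p_def by (rule map_diag[OF aX])
  ultimately have "E (\<sigma> a) (\<sigma> a) \<cdot> N + E (\<sigma> a) (\<sigma> a) \<cdot> N \<cdot> E (\<sigma> a) (\<sigma> a) + N \<cdot> E (\<sigma> a) (\<sigma> a) = N"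
    using aX \<epsilon>_sq[OF aX] by (simp add: E_prod mat.mult.assoc)
  note raw = fun_cong[OF fun_cong[OF this, of s], of t, unfolded plus_fun_apply
      E_prod_left[OF \<sigma>_in[OF aX]] E_prod_right[OF \<sigma>_in[OF aX]]]
  show ?thesis
  proof (cases "s = \<sigma> a \<and> t = \<sigma> a")
    case True
    then have st: "s = \<sigma> a" "t = \<sigma> a" by auto
    have "N s t + N s t + N s t = N s t"
      using raw unfolding st by (simp only: if_True simp_thms)
    then have "2 * N s t = 0" by (simp only: mult_2 add_right_cancel add_0 add_cancel_left_left)
    with ne two show ?thesis by (simp add: N_def)
  next
    case False
    with raw ne show ?thesis by (auto simp: N_def split: if_splits)
  qed
qed

text \<open>Each endpoint image is exactly one of \<open>s\<close> and \<open>t\<close>, and the two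
  endpoint images are distinct.\<close>

lemma edge_support:
  assumes "x \<in> X" "y \<in> X" "le x y" "x \<noteq> y" "\<phi> (E x y) s t \<noteq> 0"
  shows "(s = \<sigma> x \<and> t = \<sigma> y) \<or> (s = \<sigma> y \<and> t = \<sigma> x)"
  using edge_support_endpoint[OF assms(1-4) _ assms(5), of x]
    edge_support_endpoint[OF assms(1-4) _ assms(5), of y] assms by auto

text \<open>The image is nonzero by injectivity, and antisymmetry lets only one of the two positions
  allowed by \<open>edge_support\<close> lie in \<open>A\<close>.\<close>

lemma map_edge_cases:
  assumes xy: "x \<in> X" "y \<in> X" "le x y" "x \<noteq> y"
  obtains (forward) n where "n \<noteq> 0" "le (\<sigma> x) (\<sigma> y)" "\<not> le (\<sigma> y) (\<sigma> x)"
      "\<phi> (E x y) = n *\<^sub>s E (\<sigma> x) (\<sigma> y)"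
    | (backward) n where "n \<noteq> 0" "le (\<sigma> y) (\<sigma> x)" "\<not> le (\<sigma> x) (\<sigma> y)"
      "\<phi> (E x y) = n *\<^sub>s E (\<sigma> y) (\<sigma> x)"
proof -
  define N where "N = \<phi> (E x y)"
  have NA: "N \<in> A" using xy by (simp add: N_def)
  have "E x y x y = (1::'b)" by (simp add: E_def)
  then have "E x y \<noteq> (0 :: 'a \<Rightarrow> 'a \<Rightarrow> 'b)" by (metis zero_fun_apply zero_neq_one)
  then have "N \<noteq> 0" using map_eq_zero[OF E_inc[OF xy(1-3)]] unfolding N_def by blast
  then obtain s t where st: "N s t \<noteq> 0" by (auto simp: fun_eq_iff)
  have anti: "\<not> (le (\<sigma> x) (\<sigma> y) \<and> le (\<sigma> y) (\<sigma> x))"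
    using le_antisym[of "\<sigma> x" "\<sigma> y"] xy by auto
  have supp: "(u = \<sigma> x \<and> v = \<sigma> y) \<or> (u = \<sigma> y \<and> v = \<sigma> x)" "le u v" if "N u v \<noteq> 0" for u v
    using edge_support[OF xy] incD[OF NA] that unfolding N_def by blast+
  have eq: "N = N s t *\<^sub>s E s t"
  proof (intro ext)
    show "N u v = (N s t *\<^sub>s E s t) u v" for u v
      using supp[OF st] supp[of u v] anti by (auto simp: inc_smult_def E_def)
  qed
  from supp(1)[OF st] show ?thesis
  proof
    assume "s = \<sigma> x \<and> t = \<sigma> y"
    then show ?thesis using forward[of "N s t"] st supp(2)[OF st] anti eq unfolding N_def by auto
  next
    assume "s = \<sigma> y \<and> t = \<sigma> x"
    then show ?thesis using backward[of "N s t"] st supp(2)[OF st] anti eq unfolding N_def by auto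
  qed
qed

text \<open>The images of the orthogonal idempotents \<open>E x x + E x y\<close> and
  \<open>E y y - E x y\<close> multiply to zero in both orders. The order matching the orientation
  of the edge has the entry \<open>n * (\<epsilon> y - \<epsilon> x)\<close>.\<close>

lemma \<epsilon>_edge:
  assumes xy: "x \<in> X" "y \<in> X" "le x y" "x \<noteq> y"
  shows "\<epsilon> x = \<epsilon> y"
proof -
  have [simp]: "E x y \<in> A" "E x x \<in> A" "E y y \<in> A" using xy by simp_all
  note E_simps = mat.distrib_left mat.distrib_right mat.left_diff_distrib mat.right_diff_distrib E_prod
  have orth: "(E x x + E x y) \<cdot> (E x x + E x y) = E x x + E x y"
    "(E y y - E x y) \<cdot> (E y y - E x y) = E y y - E x y"
    "(E x x + E x y) \<cdot> (E y y - E x y) = 0" "(E y y - E x y) \<cdot> (E x x + E x y) = 0"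
    using xy by (auto simp: E_simps)
  have "\<phi> (E x x + E x y) \<cdot> \<phi> (E y y - E x y) = 0" "\<phi> (E y y - E x y) \<cdot> \<phi> (E x x + E x y) = 0"
    by (rule map_orthogonal; (rule orth)?; simp)+
  then have *: "(\<phi> (E x x) + \<phi> (E x y)) \<cdot> (\<phi> (E y y) - \<phi> (E x y)) = 0"
    "(\<phi> (E y y) - \<phi> (E x y)) \<cdot> (\<phi> (E x x) + \<phi> (E x y)) = 0"
    by (simp_all add: map_add map_diff)
  from xy show ?thesis
  proof (cases rule: map_edge_cases)
    case (forward n)
    have "n * \<epsilon> y - \<epsilon> x * n = 0"
      using fun_cong[OF fun_cong[OF *(1), of "\<sigma> x"], of "\<sigma> y"] xy
      by (simp add: map_diag forward E_simps) (simp add: inc_smult_def E_def forward(1))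
    then show ?thesis using forward by simp
  next
    case (backward n)
    have "\<epsilon> y * n - n * \<epsilon> x = 0"
      using fun_cong[OF fun_cong[OF *(2), of "\<sigma> y"], of "\<sigma> x"] xy
      by (simp add: map_diag backward E_simps) (simp add: inc_smult_def E_def backward(1))
    then show ?thesis using backward by simp
  qed
qed

text \<open>An entry of the cube of \<open>\<phi> ?e\<close> sums over walks of length three along
  the images of the four units. If the edges \<open>x y\<close> and \<open>y z\<close> have equal
  orientation, the only walk between the outer points uses the loop at \<open>\<sigma> y\<close>,
  which gives the product formula. If they differ, there is no such walk, so the coefficient of
  \<open>\<phi> (E x z)\<close> would be zero. The orientation of \<open>x z\<close> follows by
  transitivity.\<close>

lemma map_chain:
  assumes X: "x \<in> X" "y \<in> X" "z \<in> X" and le: "le x y" "le y z" and ne: "x \<noteq> y" "y \<noteq> z"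
  shows "le (\<sigma> x) (\<sigma> y) \<and> le (\<sigma> y) (\<sigma> z) \<and> le (\<sigma> x) (\<sigma> z) \<and>
      \<phi> (E x z) (\<sigma> x) (\<sigma> z) = \<phi> (E x y) (\<sigma> x) (\<sigma> y) * \<epsilon> y * \<phi> (E y z) (\<sigma> y) (\<sigma> z)
    \<or> le (\<sigma> y) (\<sigma> x) \<and> le (\<sigma> z) (\<sigma> y) \<and> le (\<sigma> z) (\<sigma> x) \<and>
      \<phi> (E x z) (\<sigma> z) (\<sigma> x) = \<phi> (E y z) (\<sigma> z) (\<sigma> y) * \<epsilon> y * \<phi> (E x y) (\<sigma> y) (\<sigma> x)"
proof -
  note E_simps = mat.distrib_left mat.distrib_right E_prod
  have xz: "le x z" "x \<noteq> z" using X le ne le_trans le_antisym by blast+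
  \<comment> \<open>This is the rank one product of \<open>E y y + E x y\<close> and
    \<open>E y y + E y z\<close>, whose product in the reverse order is
    \<open>E y y\<close>.\<close>
  let ?e = "E y y + E x y + E y z + E x z"
  have inc [simp]: "E x y \<in> A" "E y z \<in> A" "E x z \<in> A" "E y y \<in> A" using X le xz by simp_all
  have idem: "?e \<cdot> ?e = ?e" using X ne xz by (simp add: E_simps add_ac)
  have "\<phi> ?e = \<phi> (E y y) + \<phi> (E x y) + \<phi> (E y z) + \<phi> (E x z)"
    by (simp add: map_add)
  then have T: "(\<phi> (E y y) + \<phi> (E x y) + \<phi> (E y z) + \<phi> (E x z))
    \<cdot> (\<phi> (E y y) + \<phi> (E x y) + \<phi> (E y z) + \<phi> (E x z))
    \<cdot> (\<phi> (E y y) + \<phi> (E x y) + \<phi> (E y z) + \<phi> (E x z))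
    = \<phi> (E y y) + \<phi> (E x y) + \<phi> (E y z) + \<phi> (E x z)"
    using map_idempotent[OF _ idem] by (simp only: inc add_inc)
  note entry = fun_cong[OF fun_cong[OF T]]
  have y: "\<phi> (E y y) = \<epsilon> y *\<^sub>s E (\<sigma> y) (\<sigma> y)" using X(2) by (rule map_diag)
  have [simp]: "\<sigma> x \<noteq> \<sigma> y" "\<sigma> y \<noteq> \<sigma> x" "\<sigma> x \<noteq> \<sigma> z" "\<sigma> z \<noteq> \<sigma> x" "\<sigma> y \<noteq> \<sigma> z" "\<sigma> z \<noteq> \<sigma> y"
    "\<sigma> x \<in> X" "\<sigma> y \<in> X" "\<sigma> z \<in> X"
    using X ne xz by auto
  have trans: "le (\<sigma> x) (\<sigma> z)" if "le (\<sigma> x) (\<sigma> y)" "le (\<sigma> y) (\<sigma> z)"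
    using that le_trans[of "\<sigma> x" "\<sigma> y" "\<sigma> z"] by simp
  have trans': "le (\<sigma> z) (\<sigma> x)" if "le (\<sigma> z) (\<sigma> y)" "le (\<sigma> y) (\<sigma> x)"
    using that le_trans[of "\<sigma> z" "\<sigma> y" "\<sigma> x"] by simp
  from X(1,2) le(1) ne(1) show ?thesis
  proof (cases rule: map_edge_cases)
    case N: (forward n)
    from X(2,3) le(2) ne(2) show ?thesis
    proof (cases rule: map_edge_cases)
      case M: (forward m)
      from X(1,3) xz show ?thesis
      proof (cases rule: map_edge_cases)
        case K: (forward k)
        have "k = n * \<epsilon> y * m"
          using entry[of "\<sigma> x" "\<sigma> z"] unfolding y N(4) M(4) K(4)
          by (simp add: E_simps) (simp add: inc_smult_def E_def mult_ac)
        then show ?thesis using N M K by (simp add: inc_smult_def E_def)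
      qed (use N M trans in blast)
    next
      case M: (backward m)
      from X(1,3) xz show ?thesis
      proof (cases rule: map_edge_cases)
        case K: (forward k)
        have "k = 0"
          using entry[of "\<sigma> x" "\<sigma> z"] unfolding y N(4) M(4) K(4)
          by (simp add: E_simps) (simp add: inc_smult_def E_def)
        then show ?thesis using K by simp
      next
        case K: (backward k)
        have "k = 0"
          using entry[of "\<sigma> z" "\<sigma> x"] unfolding y N(4) M(4) K(4)
          by (simp add: E_simps) (simp add: inc_smult_def E_def)
        then show ?thesis using K by simp
      qed
    qed
  next
    case N: (backward n)
    from X(2,3) le(2) ne(2) show ?thesis
    proof (cases rule: map_edge_cases)
      case M: (forward m)
      from X(1,3) xz show ?thesis
      proof (cases rule: map_edge_cases)
        case K: (forward k)
        have "k = 0"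
          using entry[of "\<sigma> x" "\<sigma> z"] unfolding y N(4) M(4) K(4)
          by (simp add: E_simps) (simp add: inc_smult_def E_def)
        then show ?thesis using K by simp
      next
        case K: (backward k)
        have "k = 0"
          using entry[of "\<sigma> z" "\<sigma> x"] unfolding y N(4) M(4) K(4)
          by (simp add: E_simps) (simp add: inc_smult_def E_def)
        then show ?thesis using K by simp
      qed
    next
      case M: (backward m)
      from X(1,3) xz show ?thesis
      proof (cases rule: map_edge_cases)
        case K: (backward k)
        have "k = m * \<epsilon> y * n"
          using entry[of "\<sigma> z" "\<sigma> x"] unfolding y N(4) M(4) K(4)
          by (simp add: E_simps) (simp add: inc_smult_def E_def mult_ac)
        then show ?thesis using N M K by (simp add: inc_smult_def E_def)
      qed (use N M trans' in blast)
    qed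
  qed
qed

section \<open>Orientation of edges\<close>

text \<open>By surjectivity \<open>E (\<sigma> y) (\<sigma> z)\<close> has a preimage. Some matrix
  unit in its expansion contributes to that entry, and by \<open>edge_support\<close> this unit
  joins \<open>y\<close> and \<open>z\<close>.\<close>

lemma comparable_of_image:
  assumes "y \<in> X" "z \<in> X" "le (\<sigma> y) (\<sigma> z)"
  shows "le y z \<or> le z y"
proof (cases "y = z")
  case False
  have EA: "E (\<sigma> y) (\<sigma> z) \<in> A" using assms by simp
  then obtain f where f: "f \<in> A" "\<phi> f = E (\<sigma> y) (\<sigma> z)"
    using bij unfolding bij_betw_def by (metis imageE)
  have "\<phi> f (\<sigma> y) (\<sigma> z) \<noteq> 0" unfolding f(2) by (simp add: E_def)
  then obtain p where "p \<in> X \<times> X" "f (fst p) (snd p) * \<phi> (E (fst p) (snd p)) (\<sigma> y) (\<sigma> z) \<noteq> 0"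
    unfolding map_apply[OF f(1)] by (meson sum.neutral)
  then obtain u v where uv: "u \<in> X" "v \<in> X" "f u v \<noteq> 0" "\<phi> (E u v) (\<sigma> y) (\<sigma> z) \<noteq> 0"
    by (cases p) auto
  have le: "le u v" using incD[OF f(1) uv(3)] by simp
  have "u \<noteq> v"
    using uv(1,4) False assms(1,2) by (auto simp: map_diag inc_smult_def) (auto simp: E_def split: if_splits)
  from edge_support[OF uv(1,2) le this uv(4)] show ?thesis
    using le uv assms by auto
qed (use assms le_refl in simp)

text \<open>The orientation of the edge between \<open>x\<close> and \<open>y\<close>. As an
  equivalence it needs no choice of the lower endpoint: for distinct comparable points it is
  symmetric.\<close>

definition preserved :: "'a \<Rightarrow> 'a \<Rightarrow> bool"
  where "preserved x y \<longleftrightarrow> (le x y \<longleftrightarrow> le (\<sigma> x) (\<sigma> y))"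

lemma image_comparable:
  assumes "x \<in> X" "y \<in> X" "le x y \<or> le y x"
  shows "le (\<sigma> x) (\<sigma> y) \<or> le (\<sigma> y) (\<sigma> x)"
proof (cases "x = y")
  case False
  then show ?thesis using assms map_edge_cases[of x y] map_edge_cases[of y x] by metis
qed (use assms le_refl in simp)

text \<open>For distinct comparable points, exchanging the arguments negates both sides of the
  equivalence.\<close>

lemma preserved_sym:
  assumes "x \<in> X" "y \<in> X" "x \<noteq> y" "le x y \<or> le y x"
  shows "preserved x y \<longleftrightarrow> preserved y x"
  using image_comparable[OF assms(1,2,4)] le_antisym[of x y] le_antisym[of "\<sigma> x" "\<sigma> y"] assms
  unfolding preserved_def by auto

lemma preserved_chain:
  assumes "x \<in> X" "y \<in> X" "z \<in> X" "le x y" "le y z" "x \<noteq> y" "y \<noteq> z"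
  shows "preserved x y = preserved y z \<and> preserved x z = preserved y z"
  using map_chain[OF assms] assms le_trans[of x y z] le_antisym[of "\<sigma> x" "\<sigma> y"]
    le_antisym[of "\<sigma> y" "\<sigma> z"] le_antisym[of "\<sigma> x" "\<sigma> z"] le_antisym[of x y] le_antisym[of y z]
  unfolding preserved_def by auto

text \<open>If \<open>y\<close> and \<open>z\<close> are comparable, the three points form a chain.
  Otherwise their images are incomparable too; then \<open>x\<close> is below both or above both,
  and likewise \<open>\<sigma> x\<close> relative to the images.\<close>

lemma preserved_adjacent:
  assumes X: "x \<in> X" "y \<in> X" "z \<in> X" and ne: "x \<noteq> y" "x \<noteq> z"
    and comp: "le x y \<or> le y x" "le x z \<or> le z x"
  shows "preserved x y = preserved x z"
proof (cases "y = z")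
  case yz: False
  note sym = preserved_sym[of x y] preserved_sym[of x z] preserved_sym[of y z]
  show ?thesis
  proof (cases "le y z \<or> le z y")
    case True
    then show ?thesis
      using comp preserved_chain[of x y z] preserved_chain[of x z y] preserved_chain[of y x z]
        preserved_chain[of y z x] preserved_chain[of z x y] preserved_chain[of z y x] X ne yz sym
      by metis
  next
    case False
    then have inc: "\<not> le (\<sigma> y) (\<sigma> z)" "\<not> le (\<sigma> z) (\<sigma> y)"
      using comparable_of_image X by blast+
    have "le x y \<longleftrightarrow> le x z" using comp False le_trans X by metis
    moreover have "le (\<sigma> x) (\<sigma> y) \<longleftrightarrow> le (\<sigma> x) (\<sigma> z)"
      using image_comparable[OF X(1,2) comp(1)] image_comparable[OF X(1,3) comp(2)] inc
        le_trans[of "\<sigma> y" "\<sigma> x" "\<sigma> z"] le_trans[of "\<sigma> z" "\<sigma> x" "\<sigma> y"] X by auto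
    ultimately show ?thesis unfolding preserved_def by simp
  qed
qed simp

section \<open>From coherent orientation to multiplicativity\<close>

text \<open>Up to the relabelling \<open>\<sigma>\<close>, \<open>\<phi>\<close> scales the entry at
  \<open>x\<close>, \<open>y\<close> by \<open>c x y\<close>. The cocycle identity for
  \<open>c\<close>, twisted by \<open>r\<close>, makes the scaling compatible with products.\<close>

lemma multiplicative_of_preserved:
  assumes r: "\<And>x. x \<in> X \<Longrightarrow> \<epsilon> x = r" "r * r = 1"
    and pres: "\<And>x y. \<lbrakk>x \<in> X; y \<in> X; le x y; x \<noteq> y\<rbrakk> \<Longrightarrow> preserved x y"
    and fg: "f \<in> A" "g \<in> A"
  shows "\<phi> (f \<cdot> g) = r *\<^sub>s (\<phi> f \<cdot> \<phi> g)"
proof -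
  define c where "c x y = \<phi> (E x y) (\<sigma> x) (\<sigma> y)" for x y
  have coord: "\<phi> h (\<sigma> x) (\<sigma> y) = h x y * c x y" if "h \<in> A" "x \<in> X" "y \<in> X" for h x y
    unfolding c_def
  proof (rule map_apply_single[OF that])
    fix u v assume uv: "u \<in> X" "v \<in> X" "le u v" "(u, v) \<noteq> (x, y)"
    show "\<phi> (E u v) (\<sigma> x) (\<sigma> y) = 0"
    proof (cases "u = v")
      case True
      then show ?thesis
        using uv that by (simp add: map_diag inc_smult_def) (auto simp: E_def)
    next
      case False
      with uv(1-3) show ?thesis
      proof (cases rule: map_edge_cases)
        case (forward n)
        then show ?thesis using uv that by (auto simp: inc_smult_def E_def)
      next
        case (backward n)
        then show ?thesis using pres[OF uv(1-3) False] uv(3) by (simp add: preserved_def)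
      qed
    qed
  qed
  have diag: "c x x = r" if "x \<in> X" for x
    using that by (simp add: c_def map_diag inc_smult_def r(1)) (simp add: E_def)
  have rr: "r * (r * w) = w" "r * (w * r) = w" for w
    using r(2) by algebra+
  \<comment> \<open>Outside \<open>le x z\<close> and \<open>le z y\<close> the terms of the product
    sum vanish. In the degenerate cases the identity reduces to \<open>c x x = r\<close> and
    \<open>r * r = 1\<close>.\<close>
  have cocycle: "r * (c x z * c z y) = c x y" if X: "x \<in> X" "z \<in> X" "y \<in> X" and "le x z" "le z y" for x y z
  proof (cases "x = z \<or> z = y")
    case True
    then show ?thesis using diag rr X by auto
  next
    case False
    then have "x \<noteq> z" "z \<noteq> y" by auto
    from map_chain[OF X that(4,5) this] show ?thesis
    proof
      assume "le (\<sigma> z) (\<sigma> x) \<and> le (\<sigma> y) (\<sigma> z) \<and> le (\<sigma> y) (\<sigma> x) \<and>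
        \<phi> (E x y) (\<sigma> y) (\<sigma> x) = \<phi> (E z y) (\<sigma> y) (\<sigma> z) * \<epsilon> z * \<phi> (E x z) (\<sigma> z) (\<sigma> x)"
      then show ?thesis
        using pres[of x z] X that(4) False le_antisym[of "\<sigma> x" "\<sigma> z"] by (auto simp: preserved_def)
    qed (use r X in \<open>simp add: c_def mult_ac\<close>)
  qed
  show ?thesis
  proof (rule inc_eqI)
    fix s t assume "s \<in> X" "t \<in> X"
    then obtain x y where x: "x \<in> X" "s = \<sigma> x" and y: "y \<in> X" "t = \<sigma> y"
      using \<sigma> unfolding bij_betw_def by blast
    have "(r *\<^sub>s (\<phi> f \<cdot> \<phi> g)) s t = r * (\<Sum>w\<in>X. \<phi> f s w * \<phi> g w t)"
      by (simp add: prod_def inc_smult_def)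
    also have "\<dots> = r * (\<Sum>z\<in>X. \<phi> f (\<sigma> x) (\<sigma> z) * \<phi> g (\<sigma> z) (\<sigma> y))"
      \<comment> \<open>The inner index \<open>w\<close> is replaced by
        \<open>\<sigma> z\<close>.\<close>
      using sum.reindex_bij_betw[OF \<sigma>, of "\<lambda>w. \<phi> f s w * \<phi> g w t"] x y by simp
    also have "\<dots> = (\<Sum>z\<in>X. f x z * g z y * c x y)"
      unfolding sum_distrib_left
    proof (intro sum.cong refl)
      fix z assume z: "z \<in> X"
      show "r * (\<phi> f (\<sigma> x) (\<sigma> z) * \<phi> g (\<sigma> z) (\<sigma> y)) = f x z * g z y * c x y"
      proof (cases "f x z = 0 \<or> g z y = 0")
        case False
        then have "le x z" "le z y" using incD fg by metis+
        from cocycle[OF x(1) z y(1) this, symmetric] show ?thesis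
          using coord fg x y z by (simp add: mult_ac)
      qed (use coord fg x y z in auto)
    qed
    also have "\<dots> = \<phi> (f \<cdot> g) s t"
      using coord[OF prod_inc[OF fg] x(1) y(1)] x y by (simp add: prod_def sum_distrib_right)
    finally show "\<phi> (f \<cdot> g) s t = (r *\<^sub>s (\<phi> f \<cdot> \<phi> g)) s t" by simp
  qed (use fg in simp_all)
qed

text \<open>As in the preserved case, but with coefficients read at the transposed position; a path
  from \<open>\<sigma> y\<close> through \<open>\<sigma> z\<close> to \<open>\<sigma> x\<close>
  meets the entry of \<open>\<phi> g\<close> first, which reverses the factors.\<close>

lemma antimultiplicative_of_not_preserved:
  assumes r: "\<And>x. x \<in> X \<Longrightarrow> \<epsilon> x = r" "r * r = 1"
    and not_pres: "\<And>x y. \<lbrakk>x \<in> X; y \<in> X; le x y; x \<noteq> y\<rbrakk> \<Longrightarrow> \<not> preserved x y"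
    and fg: "f \<in> A" "g \<in> A"
  shows "\<phi> (f \<cdot> g) = r *\<^sub>s (\<phi> g \<cdot> \<phi> f)"
proof -
  define c where "c x y = \<phi> (E x y) (\<sigma> y) (\<sigma> x)" for x y
  have coord: "\<phi> h (\<sigma> y) (\<sigma> x) = h x y * c x y" if "h \<in> A" "x \<in> X" "y \<in> X" for h x y
    unfolding c_def
  proof (rule map_apply_single[OF that])
    fix u v assume uv: "u \<in> X" "v \<in> X" "le u v" "(u, v) \<noteq> (x, y)"
    show "\<phi> (E u v) (\<sigma> y) (\<sigma> x) = 0"
    proof (cases "u = v")
      case True
      then show ?thesis
        using uv that by (simp add: map_diag inc_smult_def) (auto simp: E_def)
    next
      case False
      with uv(1-3) show ?thesis
      proof (cases rule: map_edge_cases)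
        case (forward n)
        then show ?thesis using not_pres[OF uv(1-3) False] uv(3) by (simp add: preserved_def)
      next
        case (backward n)
        then show ?thesis using uv that by (auto simp: inc_smult_def E_def)
      qed
    qed
  qed
  have diag: "c x x = r" if "x \<in> X" for x
    using that by (simp add: c_def map_diag inc_smult_def r(1)) (simp add: E_def)
  have rr: "r * (r * w) = w" "r * (w * r) = w" for w
    using r(2) by algebra+
  have cocycle: "r * (c x z * c z y) = c x y" if X: "x \<in> X" "z \<in> X" "y \<in> X" and "le x z" "le z y" for x y z
  proof (cases "x = z \<or> z = y")
    case True
    then show ?thesis using diag rr X by auto
  next
    case False
    then have "x \<noteq> z" "z \<noteq> y" by auto
    from map_chain[OF X that(4,5) this] show ?thesis
    proof
      assume "le (\<sigma> x) (\<sigma> z) \<and> le (\<sigma> z) (\<sigma> y) \<and> le (\<sigma> x) (\<sigma> y) \<and>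
        \<phi> (E x y) (\<sigma> x) (\<sigma> y) = \<phi> (E x z) (\<sigma> x) (\<sigma> z) * \<epsilon> z * \<phi> (E z y) (\<sigma> z) (\<sigma> y)"
      then show ?thesis
        using not_pres[of x z] X that(4) False by (auto simp: preserved_def)
    qed (use r X in \<open>simp add: c_def mult_ac\<close>)
  qed
  show ?thesis
  proof (rule inc_eqI)
    fix s t assume "s \<in> X" "t \<in> X"
    \<comment> \<open>The column index \<open>t\<close> is now the image of \<open>x\<close>, and
      the row index \<open>s\<close> the image of \<open>y\<close>.\<close>
    then obtain x y where x: "x \<in> X" "t = \<sigma> x" and y: "y \<in> X" "s = \<sigma> y"
      using \<sigma> unfolding bij_betw_def by blast
    have "(r *\<^sub>s (\<phi> g \<cdot> \<phi> f)) s t = r * (\<Sum>w\<in>X. \<phi> g s w * \<phi> f w t)"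
      by (simp add: prod_def inc_smult_def)
    also have "\<dots> = r * (\<Sum>z\<in>X. \<phi> g (\<sigma> y) (\<sigma> z) * \<phi> f (\<sigma> z) (\<sigma> x))"
      using sum.reindex_bij_betw[OF \<sigma>, of "\<lambda>w. \<phi> g s w * \<phi> f w t"] x y by simp
    also have "\<dots> = (\<Sum>z\<in>X. f x z * g z y * c x y)"
      unfolding sum_distrib_left
    proof (intro sum.cong refl)
      fix z assume z: "z \<in> X"
      show "r * (\<phi> g (\<sigma> y) (\<sigma> z) * \<phi> f (\<sigma> z) (\<sigma> x)) = f x z * g z y * c x y"
      proof (cases "f x z = 0 \<or> g z y = 0")
        case False
        then have "le x z" "le z y" using incD fg by metis+
        from cocycle[OF x(1) z y(1) this, symmetric] show ?thesis
          using coord fg x y z by (simp add: mult_ac)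
      qed (use coord fg x y z in auto)
    qed
    also have "\<dots> = \<phi> (f \<cdot> g) s t"
      using coord[OF prod_inc[OF fg] x(1) y(1)] x y by (simp add: prod_def sum_distrib_right)
    finally show "\<phi> (f \<cdot> g) s t = (r *\<^sub>s (\<phi> g \<cdot> \<phi> f)) s t" by simp
  qed (use fg in simp_all)
qed

section \<open>Sign and orientation along connected paths\<close>

lemma \<epsilon>_constant:
  assumes conn: "poset_connected X le" and "x \<in> X" "y \<in> X"
  shows "\<epsilon> x = \<epsilon> y"
proof -
  have "(comparable_in X le)\<^sup>*\<^sup>* x y" using assms by (simp add: poset_connected_def)
  then show ?thesis
  proof (induction rule: rtranclp_induct)
    case (step u v)
    then have "u \<in> X" "v \<in> X" "le u v \<or> le v u" by (auto simp: comparable_in_def)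
    then have "\<epsilon> u = \<epsilon> v" using \<epsilon>_edge by metis
    with step show ?case by simp
  qed simp
qed

lemma preserved_constant:
  assumes conn: "poset_connected X le"
    and ab: "a \<in> X" "b \<in> X" "a \<noteq> b" "le a b"
    and xy: "x \<in> X" "y \<in> X" "x \<noteq> y" "le x y"
  shows "preserved a b = preserved x y"
proof -
  have "(comparable_in X le)\<^sup>*\<^sup>* a x" using conn ab xy by (simp add: poset_connected_def)
  \<comment> \<open>The invariant covers every edge at the current point, so that the next step may
    leave along any of them.\<close>
  then have "\<forall>y\<in>X. x \<noteq> y \<and> (le x y \<or> le y x) \<longrightarrow> preserved a b = preserved x y"
  proof (induction rule: rtranclp_induct)
    case base
    then show ?case using preserved_adjacent[of a b] ab by auto
  next
    case (step u v)
    then have uv: "u \<in> X" "v \<in> X" "le u v \<or> le v u" by (auto simp: comparable_in_def)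
    show ?case
    \<comment> \<open>A path may pause, since \<open>comparable_in\<close> is reflexive on
      \<open>X\<close>.\<close>
    proof (cases "u = v")
      case False
      have "preserved a b = preserved u v" using step.IH uv False by blast
      also have "\<dots> = preserved v u" using preserved_sym[OF uv(1,2) False uv(3)] .
      finally show ?thesis using preserved_adjacent[of v u] uv False by blast
    qed (use step.IH in simp)
  qed
  with xy show ?thesis by blast
qed

lemma multiplicative_or_antimultiplicative:
  assumes conn: "poset_connected X le"
  shows "\<exists>r. (r = - 1 \<or> r = 1) \<and>
    ((\<forall>f\<in>A. \<forall>g\<in>A. \<phi> (f \<cdot> g) = r *\<^sub>s (\<phi> f \<cdot> \<phi> g)) \<or>
     (\<forall>f\<in>A. \<forall>g\<in>A. \<phi> (f \<cdot> g) = r *\<^sub>s (\<phi> g \<cdot> \<phi> f)))"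
proof -
  \<comment> \<open>For empty \<open>X\<close> there is no sign to read off, and 1 is
    chosen.\<close>
  obtain r where r: "\<And>x. x \<in> X \<Longrightarrow> \<epsilon> x = r" "r = - 1 \<or> r = 1"
  proof (cases "X = {}")
    case False
    then obtain x0 where "x0 \<in> X" by blast
    then show ?thesis using that[of "\<epsilon> x0"] \<epsilon>_constant[OF conn] \<epsilon> by metis
  qed (use that[of 1] in simp)
  then have rr: "r * r = 1" by auto
  \<comment> \<open>Without any edge both alternatives hold; otherwise one edge decides for
    all.\<close>
  have "(\<forall>x\<in>X. \<forall>y\<in>X. le x y \<and> x \<noteq> y \<longrightarrow> preserved x y) \<or>
      (\<forall>x\<in>X. \<forall>y\<in>X. le x y \<and> x \<noteq> y \<longrightarrow> \<not> preserved x y)"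
    using preserved_constant[OF conn] by blast
  then show ?thesis
  proof
    assume "\<forall>x\<in>X. \<forall>y\<in>X. le x y \<and> x \<noteq> y \<longrightarrow> preserved x y"
    then have "\<phi> (f \<cdot> g) = r *\<^sub>s (\<phi> f \<cdot> \<phi> g)" if "f \<in> A" "g \<in> A" for f g
      using multiplicative_of_preserved[of r f g] r(1) rr that by blast
    then show ?thesis using r(2) by blast
  next
    assume "\<forall>x\<in>X. \<forall>y\<in>X. le x y \<and> x \<noteq> y \<longrightarrow> \<not> preserved x y"
    then have "\<phi> (f \<cdot> g) = r *\<^sub>s (\<phi> g \<cdot> \<phi> f)" if "f \<in> A" "g \<in> A" for f g
      using antimultiplicative_of_not_preserved[of r f g] r(1) rr that by blast
    then show ?thesis using r(2) by blast
  qed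
qed

end

section \<open>Diagonalization by conjugation\<close>

context tripotent_map
begin

text \<open>Diagonal entries multiply separately, so each is a root of \<open>d * d * d = d\<close>
  in the field.\<close>

lemma map_diag_entry_cases:
  assumes "x \<in> X" "s \<in> X" shows "\<phi> (E x x) s s = 0 \<or> \<phi> (E x x) s s = 1 \<or> \<phi> (E x x) s s = - 1"
proof -
  let ?p = "\<phi> (E x x)" let ?d = "?p s s"
  have pA: "?p \<in> A" using assms by simp
  have "?p \<cdot> ?p \<cdot> ?p = ?p" by (rule map_idempotent) (use assms in \<open>simp_all add: E_prod\<close>)
  then have "(?p \<cdot> ?p \<cdot> ?p) s s = ?d" by simp
  then have "?d * ?d * ?d = ?d" using pA assms by (simp add: prod_diag)
  moreover have "?d * (?d - 1) * (?d + 1) = ?d * ?d * ?d - ?d" by (simp add: algebra_simps)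
  ultimately have "?d * (?d - 1) * (?d + 1) = 0" by simp
  then show ?thesis by (simp add: eq_neg_iff_add_eq_0)
qed

text \<open>With a zero diagonal, \<open>?p = ?p \<cdot> (?p \<cdot> ?p)\<close> would force
  \<open>?p = 0\<close>, against injectivity.\<close>

lemma exists_diag_entry:
  assumes "x \<in> X" shows "\<exists>s\<in>X. \<phi> (E x x) s s \<noteq> 0"
proof (rule ccontr)
  let ?p = "\<phi> (E x x)"
  assume none: "\<not> ?thesis"
  have pA: "?p \<in> A" using assms by simp
  have p3: "?p \<cdot> ?p \<cdot> ?p = ?p" by (rule map_idempotent) (use assms in \<open>simp_all add: E_prod\<close>)
  have "?p = 0"
  proof (rule eq_zero_of_factor_strictly_upper[OF pA prod_inc[OF pA pA]])
    show "(?p \<cdot> ?p) s s = 0" if "s \<in> X" for s using none that pA by (simp add: prod_diag)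
    show "?p = ?p \<cdot> (?p \<cdot> ?p)" using p3 by (simp add: mat.mult.assoc)
  qed
  then have "E x x = (0 :: 'a \<Rightarrow> 'a \<Rightarrow> 'b)" using map_eq_zero assms by simp
  then have "E x x x x = (0 :: 'b)" by (metis zero_fun_apply)
  then show False by (simp add: E_def)
qed

text \<open>Each \<open>p x\<close> has a nonzero diagonal entry, at a position
  \<open>\<sigma> x\<close>. Orthogonality makes the diagonals of different \<open>p x\<close>
  disjoint, so \<open>\<sigma>\<close> is injective and, by finiteness, a permutation. The matrices
  \<open>B\<close> and \<open>B'\<close> then conjugate the family \<open>p\<close> to its diagonal
  part.\<close>

lemma exists_diagonalization:
  obtains \<sigma> \<epsilon> B B' where "B \<in> A" "B' \<in> A" "B' \<cdot> B = one" "B \<cdot> B' = one"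
    "bij_betw \<sigma> X X" "\<And>x. x \<in> X \<Longrightarrow> B' \<cdot> \<phi> (E x x) \<cdot> B = \<epsilon> x *\<^sub>s E (\<sigma> x) (\<sigma> x)"
    "\<And>x. x \<in> X \<Longrightarrow> \<epsilon> x = 1 \<or> \<epsilon> x = - 1"
proof -
  define p where "p x = \<phi> (E x x)" for x
  have pA [simp]: "p x \<in> A" if "x \<in> X" for x using that by (simp add: p_def)
  have p3: "p x \<cdot> (p x \<cdot> p x) = p x" if "x \<in> X" for x
    unfolding p_def mat.mult.assoc[symmetric]
    by (rule map_idempotent) (use that in \<open>simp_all add: E_prod\<close>)
  have p_orth: "p x \<cdot> p y = 0" if "x \<in> X" "y \<in> X" "x \<noteq> y" for x y
    unfolding p_def by (rule map_orthogonal) (use that in \<open>simp_all add: E_prod\<close>)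
  obtain \<sigma> where \<sigma>: "\<And>x. x \<in> X \<Longrightarrow> \<sigma> x \<in> X \<and> p x (\<sigma> x) (\<sigma> x) \<noteq> 0"
    using exists_diag_entry unfolding p_def by metis
  have disj: "p x s s * p y s s = 0" if "x \<in> X" "y \<in> X" "x \<noteq> y" "s \<in> X" for x y s
    using p_orth[OF that(1-3)] prod_diag[of "p x" "p y" s] that by simp
  have inj: "inj_on \<sigma> X"
  proof (rule inj_onI, rule ccontr)
    fix x y assume xy: "x \<in> X" "y \<in> X" "\<sigma> x = \<sigma> y" "x \<noteq> y"
    then show False using disj[of x y "\<sigma> x"] \<sigma>[of x] \<sigma>[of y] by simp
  qed
  have "\<sigma> ` X = X" using \<sigma> inj fin by (intro endo_inj_surj) auto
  with inj have bij\<sigma>: "bij_betw \<sigma> X X" by (simp add: bij_betw_def)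
  define \<epsilon> where "\<epsilon> x = p x (\<sigma> x) (\<sigma> x)" for x
  have \<epsilon>: "\<epsilon> x = 1 \<or> \<epsilon> x = - 1" if "x \<in> X" for x
    using map_diag_entry_cases[OF that, of "\<sigma> x"] \<sigma>[OF that] by (auto simp: \<epsilon>_def p_def)
  define e where "e x = (E (\<sigma> x) (\<sigma> x) :: 'a \<Rightarrow> 'a \<Rightarrow> 'b)" for x
  have eA [simp]: "e x \<in> A" if "x \<in> X" for x using \<sigma>[OF that] by (simp add: e_def)
  \<comment> \<open>The standard intertwiners between the idempotents \<open>p x \<cdot> p x\<close>
    and \<open>e x\<close>. In \<open>B' \<cdot> B\<close> the cross terms vanish, and each corner
    is \<open>\<epsilon> x * \<epsilon> x = 1\<close> times \<open>e x\<close>.\<close>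
  define B where "B = (\<Sum>x\<in>X. p x \<cdot> p x \<cdot> e x)"
  define B' where "B' = (\<Sum>x\<in>X. e x \<cdot> (p x \<cdot> p x))"
  have BA: "B \<in> A" "B' \<in> A" unfolding B_def B'_def by (auto intro!: sum_inc)
  have pick: "(\<Sum>y\<in>X. if y = x then h else 0) = h" if "x \<in> X" for x and h :: "'a \<Rightarrow> 'a \<Rightarrow> 'b"
    using that fin by simp
  have B'p: "B' \<cdot> p x = e x \<cdot> p x" if "x \<in> X" for x
  proof -
    have "B' \<cdot> p x = (\<Sum>y\<in>X. if y = x then e x \<cdot> p x else 0)"
      unfolding B'_def sum_prod_left
      using that p3 p_orth by (intro sum.cong) (auto simp: mat.mult.assoc)
    then show ?thesis using pick[OF that] by simp
  qed
  have pB: "p x \<cdot> B = p x \<cdot> e x" if "x \<in> X" for x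
  proof -
    have "p x \<cdot> (p y \<cdot> p y \<cdot> e y) = (if y = x then p x \<cdot> e x else 0)" if "y \<in> X" for y
      using that \<open>x \<in> X\<close> p3[of x] p_orth[of x y]
      by (cases "y = x") (simp_all add: mat.mult.assoc[symmetric])
    then have "p x \<cdot> B = (\<Sum>y\<in>X. if y = x then p x \<cdot> e x else 0)"
      unfolding B_def sum_prod_right by (intro sum.cong) auto
    then show ?thesis using pick[OF that] by simp
  qed
  have corner: "e x \<cdot> f \<cdot> e x = f (\<sigma> x) (\<sigma> x) *\<^sub>s e x" if "x \<in> X" for x f
    using \<sigma>[OF that] by (simp add: e_def E_corner)
  have "B' \<cdot> (p x \<cdot> p x \<cdot> e x) = e x" if "x \<in> X" for x
  proof -
    have "B' \<cdot> (p x \<cdot> p x \<cdot> e x) = e x \<cdot> (p x \<cdot> p x) \<cdot> e x"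
      using B'p[OF that] by (metis mat.mult.assoc)
    also have "\<dots> = (\<epsilon> x * \<epsilon> x) *\<^sub>s e x"
      using that \<sigma>[OF that] by (simp add: corner prod_diag \<epsilon>_def)
    finally show ?thesis using \<epsilon>[OF that] by auto
  qed
  then have "B' \<cdot> B = (\<Sum>x\<in>X. e x)"
    unfolding B_def sum_prod_right by (intro sum.cong) auto
  also have "\<dots> = one"
    unfolding one_def e_def by (rule sum.reindex_bij_betw[OF bij\<sigma>])
  finally have inv: "B' \<cdot> B = one" .
  show ?thesis
  proof (rule that[OF BA inv right_inverse_of_left_inverse[OF BA inv] bij\<sigma>])
    fix x assume x: "x \<in> X"
    have "B' \<cdot> \<phi> (E x x) \<cdot> B = e x \<cdot> p x \<cdot> e x"
      using B'p[OF x] pB[OF x] unfolding p_def by (metis mat.mult.assoc)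
    then show "B' \<cdot> \<phi> (E x x) \<cdot> B = \<epsilon> x *\<^sub>s E (\<sigma> x) (\<sigma> x)"
      using corner[OF x] by (simp add: \<epsilon>_def e_def)
  qed (use \<epsilon> in blast)
qed

text \<open>Conjugation by \<open>B\<close> is an algebra automorphism. It carries
  \<open>\<phi>\<close> to normal form, and undoing it preserves either product rule.\<close>

lemma multiplicative_or_antimultiplicative_up_to_sign:
  assumes conn: "poset_connected X le"
  shows "\<exists>r. (r = - 1 \<or> r = 1) \<and>
    ((\<forall>f\<in>A. \<forall>g\<in>A. \<phi> (f \<cdot> g) = r *\<^sub>s (\<phi> f \<cdot> \<phi> g)) \<or>
     (\<forall>f\<in>A. \<forall>g\<in>A. \<phi> (f \<cdot> g) = r *\<^sub>s (\<phi> g \<cdot> \<phi> f)))"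
proof -
  obtain \<sigma> \<epsilon> B B' where B: "B \<in> A" "B' \<in> A" "B' \<cdot> B = one" "B \<cdot> B' = one"
    and \<sigma>: "bij_betw \<sigma> X X"
    and diag: "\<And>x. x \<in> X \<Longrightarrow> B' \<cdot> \<phi> (E x x) \<cdot> B = \<epsilon> x *\<^sub>s E (\<sigma> x) (\<sigma> x)"
    and \<epsilon>: "\<And>x. x \<in> X \<Longrightarrow> \<epsilon> x = 1 \<or> \<epsilon> x = - 1"
    by (rule exists_diagonalization, rule that)
  have cancel: "B \<cdot> (B' \<cdot> f) = f" "B' \<cdot> (B \<cdot> f) = f" if "f \<in> A" for f
    using B that by (simp_all add: mat.mult.assoc[symmetric])
  define conj where "conj f = B' \<cdot> f \<cdot> B" for f
  have conj_inc: "conj f \<in> A" if "f \<in> A" for f using B that by (simp add: conj_def)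
  have conj_prod: "conj f \<cdot> conj g = conj (f \<cdot> g)" if "f \<in> A" "g \<in> A" for f g
    using cancel B that by (simp add: conj_def mat.mult.assoc)
  have conj_inv: "B \<cdot> conj f \<cdot> B' = f" if "f \<in> A" for f
    using cancel B that by (simp add: conj_def mat.mult.assoc)
  have conj_bij: "bij_betw conj A A"
  proof (rule bij_betw_byWitness[where f' = "\<lambda>f. B \<cdot> f \<cdot> B'"])
    show "\<forall>f\<in>A. conj (B \<cdot> f \<cdot> B') = f"
      using cancel B by (simp add: conj_def mat.mult.assoc)
  qed (use conj_inv conj_inc B in auto)
  interpret D: diagonal_tripotent_map X le "\<lambda>f. conj (\<phi> f)" \<sigma> \<epsilon>
  proof unfold_locales
    show "inc_linear X le (\<lambda>f. conj (\<phi> f))"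
      unfolding inc_linear_def inc_add_eq_plus
      by (simp add: map_add map_smult conj_def mat.distrib_left mat.distrib_right)
    show "bij_betw (\<lambda>f. conj (\<phi> f)) A A"
      using bij_betw_trans[OF bij conj_bij] by (simp add: comp_def)
    show "(\<lambda>f. conj (\<phi> f)) ` tripotents X le \<subseteq> tripotents X le"
    proof
      fix h assume "h \<in> (\<lambda>f. conj (\<phi> f)) ` tripotents X le"
      then obtain f where f: "h = conj (\<phi> f)" "f \<in> A" "f \<cdot> f \<cdot> f = f"
        by (auto simp: tripotents_iff)
      then have "\<phi> f \<cdot> \<phi> f \<cdot> \<phi> f = \<phi> f" by (intro map_tripotent)
      then show "h \<in> tripotents X le"
        using f(1,2) by (simp add: tripotents_iff conj_inc conj_prod)
    qed
    show "conj (\<phi> (E x x)) = \<epsilon> x *\<^sub>s E (\<sigma> x) (\<sigma> x)" if "x \<in> X" for x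
      using diag[OF that] by (simp add: conj_def)
  qed (use two three \<sigma> \<epsilon> in auto)
  \<comment> \<open>With \<open>h\<close> kept separate from \<open>f\<close> and \<open>g\<close>,
    one fact serves both orders of multiplication.\<close>
  have transfer: "\<phi> h = r *\<^sub>s (\<phi> f \<cdot> \<phi> g)"
    if "h \<in> A" "f \<in> A" "g \<in> A" "conj (\<phi> h) = r *\<^sub>s (conj (\<phi> f) \<cdot> conj (\<phi> g))" for h f g r
  proof -
    have "\<phi> h = B \<cdot> conj (\<phi> h) \<cdot> B'" using conj_inv that(1) by simp
    also have "\<dots> = r *\<^sub>s (B \<cdot> conj (\<phi> f \<cdot> \<phi> g) \<cdot> B')"
      using that by (simp add: conj_prod)
    finally show ?thesis using conj_inv that(2,3) by simp
  qed
  obtain r where r: "r = - 1 \<or> r = 1" and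
    mult: "(\<forall>f\<in>A. \<forall>g\<in>A. conj (\<phi> (f \<cdot> g)) = r *\<^sub>s (conj (\<phi> f) \<cdot> conj (\<phi> g))) \<or>
      (\<forall>f\<in>A. \<forall>g\<in>A. conj (\<phi> (f \<cdot> g)) = r *\<^sub>s (conj (\<phi> g) \<cdot> conj (\<phi> f)))"
    using D.multiplicative_or_antimultiplicative[OF conn] by (elim exE conjE)
  from mult have "(\<forall>f\<in>A. \<forall>g\<in>A. \<phi> (f \<cdot> g) = r *\<^sub>s (\<phi> f \<cdot> \<phi> g)) \<or>
     (\<forall>f\<in>A. \<forall>g\<in>A. \<phi> (f \<cdot> g) = r *\<^sub>s (\<phi> g \<cdot> \<phi> f))"
    by (elim disj_forward) (intro ballI transfer; simp)+
  with r show ?thesis by (intro exI conjI)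
qed

end

section \<open>Absorbing the sign into the map\<close>

theorem theorem6p6:
  fixes X :: "'a set" and le :: "'a \<Rightarrow> 'a \<Rightarrow> bool"
    and \<phi> :: "('a \<Rightarrow> 'a \<Rightarrow> 'b::field) \<Rightarrow> ('a \<Rightarrow> 'a \<Rightarrow> 'b)"
  assumes "finite X" and "is_poset X le" and "poset_connected X le"
    and "(2::'b) \<noteq> 0" and "(3::'b) \<noteq> 0"
    and "inc_linear X le \<phi>"
    and "bij_betw \<phi> (incidence X le) (incidence X le)"
    and "\<phi> ` tripotents X le \<subseteq> tripotents X le"
  shows "\<exists>r::'b. (r = -1 \<or> r = 1) \<and>
           (\<exists>\<psi>. (inc_automorphism X le \<psi> \<or> inc_anti_automorphism X le \<psi>) \<and>
                 (\<forall>f\<in>incidence X le. \<phi> f = inc_smult r (\<psi> f)))"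
proof -
  interpret tripotent_map X le \<phi> using assms by unfold_locales
  obtain r where r: "r = - 1 \<or> r = 1"
    and mult: "(\<forall>f\<in>A. \<forall>g\<in>A. \<phi> (f \<cdot> g) = r *\<^sub>s (\<phi> f \<cdot> \<phi> g)) \<or>
      (\<forall>f\<in>A. \<forall>g\<in>A. \<phi> (f \<cdot> g) = r *\<^sub>s (\<phi> g \<cdot> \<phi> f))"
    using multiplicative_or_antimultiplicative_up_to_sign[OF assms(3)] by blast
  have rr: "r * r = 1" using r by auto
  \<comment> \<open>As \<open>r\<close> is its own inverse, multiplying by \<open>r\<close> moves
    the sign out of the product rule: each of the two factors on the right receives one
    \<open>r\<close>.\<close>
  define \<psi> where "\<psi> f = r *\<^sub>s \<phi> f" for f
  have bij_r: "bij_betw (\<lambda>f. r *\<^sub>s f) A A"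
    by (rule bij_betw_byWitness[where f' = "\<lambda>f. r *\<^sub>s f"]) (auto simp: rr)
  have "bij_betw \<psi> A A"
    using bij_betw_trans[OF bij bij_r] by (simp add: comp_def \<psi>_def[abs_def])
  moreover have "inc_linear X le \<psi>"
    unfolding inc_linear_def \<psi>_def inc_add_eq_plus
    by (simp add: map_add map_smult smult_add mult.commute)
  moreover have "(\<forall>f\<in>A. \<forall>g\<in>A. \<psi> (inc_mult X le f g) = inc_mult X le (\<psi> f) (\<psi> g)) \<or>
      (\<forall>f\<in>A. \<forall>g\<in>A. \<psi> (inc_mult X le f g) = inc_mult X le (\<psi> g) (\<psi> f))"
    using mult by (elim disj_forward) (simp_all add: \<psi>_def inc_mult_eq_prod)
  ultimately have "inc_automorphism X le \<psi> \<or> inc_anti_automorphism X le \<psi>"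
    unfolding inc_automorphism_def inc_anti_automorphism_def by blast
  moreover have "\<forall>f\<in>A. \<phi> f = r *\<^sub>s \<psi> f" by (simp add: \<psi>_def rr)
  ultimately show ?thesis using r by blast
qed

end
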